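(* Let $m\ge n\ge 1$, $A\in\mathbb{R}^{m\times n}$, let $Q\in\mathbb{R}^{n\times n}$ and $R\in\mathbb{R}^{m\times m}$ be symmetric positive definite, let $d\in\mathbb{R}^m$, $\mu\in\mathbb{R}^n$, and put $b=d-A\mu$. Let $L_Q\in\mathbb{R}^{n\times n}$ and $L_R\in\mathbb{R}^{m\times m}$ satisfy $Q^{-1}=L_Q^\top L_Q$ and $R^{-1}=L_R^\top L_R$. Fix $\lambda\ge 0$ and $k\ge 1$, and suppose the generalized Golub–Kahan process with input $A,R,Q,b$ produces $\beta_1$, $B_k$ and $V_k$ (without breakdown). Let $z_k\in\mathbb{R}^k$ be the exact solution of the gen-LSQR subproblem $$\min_{z\in\mathbb{R}^k}\ \tfrac12\|B_kz-\beta_1e_1\|_2^2+\tfrac{\lambda^2}{2}\|z\|_2^2 .$$ Let $w_k\in\mathbb{R}^n$ be the $k$-th iterate of LSQR (exact arithmetic, zero initial guess) applied to the Tikhonov problem $$\min_{w\in\mathbb{R}^n}\ \left\|\begin{pmatrix} L_RAL_Q^{-1}\\ \lambda I\end{pmatrix}w-\begin{pmatrix}L_Rb\\ 0\end{pmatrix}\right\|_2^2 .$$ Then $$\mu+QV_kz_k=\mu+L_Q^{-1}w_k .$$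
   Context: For a symmetric positive definite matrix $M$, $\|x\|_M=\sqrt{x^\top Mx}$. For a square matrix $C$ and a vector $g$, $\mathcal{K}_k(C,g)=\mathrm{Span}\{g,Cg,\dots,C^{k-1}g\}$. $e_1$ is the first standard basis vector (of $\mathbb{R}^{k+1}$ here). Generalized Golub–Kahan (gen-GK) bidiagonalization with input $A,R,Q,b$: set $\beta_1=\|b\|_{R^{-1}}$, $u_1=b/\beta_1$, $\alpha_1v_1=A^\top R^{-1}u_1$; for $i=1,\dots,k$ set $$\beta_{i+1}u_{i+1}=AQv_i-\alpha_iu_i,\qquad \alpha_{i+1}v_{i+1}=A^\top R^{-1}u_{i+1}-\beta_{i+1}v_i,$$ where the scalars $\alpha_i,\beta_i\ge 0$ are chosen so that $\|u_i\|_{R^{-1}}=\|v_i\|_Q=1$. "Without breakdown" means $\alpha_i>0$ and $\beta_i>0$ for $1\le i\le k+1$, so that all the vectors are defined. Put $V_k=[v_1,\dots,v_k]\in\mathbb{R}^{n\times k}$, and let $B_k\in\mathbb{R}^{(k+1)\times k}$ be the lower bidiagonal matrix with diagonal entries $(B_k)_{ii}=\alpha_i$ and subdiagonal entries $(B_k)_{i+1,i}=\beta_{i+1}$ ($1\le i\le k$), all other entries being zero. LSQR: for a least squares problem $\min_w\|Cw-c\|_2^2$, the $k$-th LSQR iterate with zero initial guess (in exact arithmetic) is the minimizer of $\|Cw-c\|_2$ over $w\in\mathcal{K}_k(C^\top C,C^\top c)$. *)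

theory Defs
  imports Jordan_Normal_Form.VS_Connect
begin

definition sym_pos_def :: "nat \<Rightarrow> real mat \<Rightarrow> bool" where
  "sym_pos_def n M \<longleftrightarrow> M \<in> carrier_mat n n \<and> transpose_mat M = M \<and>
     (\<forall>x \<in> carrier_vec n. x \<noteq> 0\<^sub>v n \<longrightarrow> x \<bullet> (M *\<^sub>v x) > 0)"

text \<open>The inverse in the ring of square matrices. It is unspecified for a singular argument;
  it is only applied to invertible matrices below.\<close>

definition mat_inv :: "real mat \<Rightarrow> real mat" where
  "mat_inv M = inv\<^bsub>ring_mat TYPE(real) (dim_row M) ()\<^esub> M"

definition euclid_norm :: "real vec \<Rightarrow> real" where
  "euclid_norm x = sqrt (x \<bullet> x)"

definition weighted_norm :: "real mat \<Rightarrow> real vec \<Rightarrow> real" where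
  "weighted_norm M x = sqrt (x \<bullet> (M *\<^sub>v x))"

definition krylov :: "nat \<Rightarrow> real mat \<Rightarrow> real vec \<Rightarrow> real vec set" where
  "krylov k C g =
     LinearCombinations.module.span class_ring (module_vec TYPE(real) (dim_vec g))
       ((\<lambda>j. (C ^\<^sub>m j) *\<^sub>v g) ` {..<k})"

text \<open>The coefficients and vectors are indexed from 1, as in the usual notation; the values at
  index 0 and beyond \<open>k + 1\<close> are irrelevant.\<close>

definition gen_GK ::
  "real mat \<Rightarrow> real mat \<Rightarrow> real mat \<Rightarrow> real vec \<Rightarrow> nat \<Rightarrow>
   (nat \<Rightarrow> real) \<Rightarrow> (nat \<Rightarrow> real) \<Rightarrow> (nat \<Rightarrow> real vec) \<Rightarrow> (nat \<Rightarrow> real vec) \<Rightarrow> bool" where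
  "gen_GK A R Q b k \<alpha> \<beta> u v \<longleftrightarrow>
     (\<forall>i \<in> {1..k+1}. u i \<in> carrier_vec (dim_row A) \<and> v i \<in> carrier_vec (dim_col A)) \<and>
     (\<forall>i \<in> {1..k+1}. \<alpha> i \<ge> 0 \<and> \<beta> i \<ge> 0) \<and>
     (\<forall>i \<in> {1..k+1}. weighted_norm (mat_inv R) (u i) = 1 \<and> weighted_norm Q (v i) = 1) \<and>
     \<beta> 1 = weighted_norm (mat_inv R) b \<and>
     u 1 = (1 / \<beta> 1) \<cdot>\<^sub>v b \<and>
     \<alpha> 1 \<cdot>\<^sub>v v 1 = (transpose_mat A * mat_inv R) *\<^sub>v u 1 \<and>
     (\<forall>i \<in> {1..k}.
        \<beta> (i+1) \<cdot>\<^sub>v u (i+1) = (A * Q) *\<^sub>v v i - \<alpha> i \<cdot>\<^sub>v u i \<and>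
        \<alpha> (i+1) \<cdot>\<^sub>v v (i+1) =
          (transpose_mat A * mat_inv R) *\<^sub>v u (i+1) - \<beta> (i+1) \<cdot>\<^sub>v v i)"

definition no_breakdown :: "nat \<Rightarrow> (nat \<Rightarrow> real) \<Rightarrow> (nat \<Rightarrow> real) \<Rightarrow> bool" where
  "no_breakdown k \<alpha> \<beta> \<longleftrightarrow> (\<forall>i \<in> {1..k+1}. \<alpha> i > 0 \<and> \<beta> i > 0)"

definition V_mat :: "nat \<Rightarrow> nat \<Rightarrow> (nat \<Rightarrow> real vec) \<Rightarrow> real mat" where
  "V_mat n k v = mat_of_cols n (map v [1..<k+1])"

text \<open>Matrix positions are counted from 0, so position \<open>(i, j)\<close> holds the entry that is
  numbered \<open>(i + 1, j + 1)\<close> in the usual notation.\<close>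

definition B_mat :: "nat \<Rightarrow> (nat \<Rightarrow> real) \<Rightarrow> (nat \<Rightarrow> real) \<Rightarrow> real mat" where
  "B_mat k \<alpha> \<beta> = mat (k+1) k
     (\<lambda>(i, j). if i = j then \<alpha> (j+1) else if i = j+1 then \<beta> (j+2) else 0)"

definition gen_LSQR_solution ::
  "nat \<Rightarrow> real \<Rightarrow> (nat \<Rightarrow> real) \<Rightarrow> (nat \<Rightarrow> real) \<Rightarrow> real vec \<Rightarrow> bool" where
  "gen_LSQR_solution k lam \<alpha> \<beta> z \<longleftrightarrow>
     is_arg_min
       (\<lambda>z. 1/2 * (euclid_norm (B_mat k \<alpha> \<beta> *\<^sub>v z - \<beta> 1 \<cdot>\<^sub>v unit_vec (k+1) 0))\<^sup>2
            + lam\<^sup>2 / 2 * (euclid_norm z)\<^sup>2)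
       (\<lambda>z. z \<in> carrier_vec k) z"

definition LSQR_iterate :: "nat \<Rightarrow> real mat \<Rightarrow> real vec \<Rightarrow> real vec \<Rightarrow> bool" where
  "LSQR_iterate k C c w \<longleftrightarrow>
     is_arg_min (\<lambda>w. euclid_norm (C *\<^sub>v w - c))
       (\<lambda>w. w \<in> krylov k (transpose_mat C * C) (transpose_mat C *\<^sub>v c)) w"

end

theory Submission
  imports Defs
begin

text \<open>With \<open>P = L\<^sub>Q\<^sup>-\<^sup>1\<close> (so that \<open>P P\<^sup>T = Q\<close>) and \<open>S = L\<^sub>R A P\<close>, the vectors \<open>p\<^sub>i = L\<^sub>R u\<^sub>i\<close> and
  \<open>q\<^sub>i = P\<^sup>T v\<^sub>i\<close> are those of the ordinary Golub-Kahan process for \<open>S\<close>, hence orthonormal. For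
  \<open>W\<close> with columns \<open>q\<^sub>1, \<dots>, q\<^sub>k\<close> this makes the Tikhonov residual at \<open>W y\<close> equal to the
  gen-LSQR objective at \<open>y\<close>. The Krylov space of the Tikhonov problem is the range of \<open>W\<close>,
  because adding \<open>\<lambda>\<^sup>2 I\<close> to \<open>S\<^sup>T S\<close> does not change Krylov spaces. Both minimizers therefore
  minimize the same strictly convex function of \<open>y\<close>, so \<open>w = W z\<close> and \<open>P w = P P\<^sup>T V z = Q V z\<close>.\<close>

section \<open>Matrix inverses and factors of inverse positive definite matrices\<close>

lemma mat_inv_left:
  assumes M: "M \<in> carrier_mat n n" and "det M \<noteq> 0"
  shows "mat_inv M * M = 1\<^sub>m n"
proof -
  interpret ring "ring_mat TYPE(real) n ()" by (rule ring_mat)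
  have U: "M \<in> Units (ring_mat TYPE(real) n ())"
    using det_non_zero_imp_unit[OF M \<open>det M \<noteq> 0\<close>] .
  show ?thesis using Units_l_inv[OF U] M
    by (auto simp: mat_inv_def ring_mat_simps)
qed

lemma mat_inv_unique:
  assumes M: "M \<in> carrier_mat n n" and N: "N \<in> carrier_mat n n" and MN: "M * N = 1\<^sub>m n"
  shows "mat_inv M = N"
proof -
  interpret ring "ring_mat TYPE(real) n ()" by (rule ring_mat)
  have "N * M = 1\<^sub>m n" by (rule mat_mult_left_right_inverse[OF M N MN])
  then show ?thesis
    using inv_unique'[of M N] M N MN by (auto simp: mat_inv_def ring_mat_simps)
qed

lemma sym_pos_def_inv:
  assumes "sym_pos_def n M"
  shows "mat_inv M * M = 1\<^sub>m n"
proof -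
  have M: "M \<in> carrier_mat n n" using assms by (simp add: sym_pos_def_def)
  have "det M \<noteq> 0"
  proof
    assume "det M = 0"
    then obtain x where x: "x \<in> carrier_vec n" "x \<noteq> 0\<^sub>v n" "M *\<^sub>v x = 0\<^sub>v n"
      using det_0_iff_vec_prod_zero_field[OF M] by auto
    moreover have "x \<bullet> (M *\<^sub>v x) > 0" using assms x(1,2) by (simp add: sym_pos_def_def)
    ultimately show False by simp
  qed
  then show ?thesis by (rule mat_inv_left[OF M])
qed

text \<open>One-sided inverses of square matrices are two-sided, so
  \<open>transpose_mat L * (L * Q) = 1\<^sub>m n\<close> can be rotated to
  \<open>L * (Q * transpose_mat L) = 1\<^sub>m n\<close>; invertibility of \<open>L\<close> comes as
  a by-product. The product of \<open>Q * transpose_mat L\<close> with its transpose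
  \<open>L * Q\<close> then collapses to \<open>Q\<close>.\<close>

lemma mat_inv_factor:
  assumes Q: "sym_pos_def n Q" and L: "L \<in> carrier_mat n n"
    and fac: "mat_inv Q = transpose_mat L * L"
  shows "mat_inv L = Q * transpose_mat L"
    and "mat_inv L * transpose_mat (mat_inv L) = Q"
proof -
  have Qc: "Q \<in> carrier_mat n n" and Qt: "transpose_mat Q = Q"
    using Q by (auto simp: sym_pos_def_def)
  have "transpose_mat L * (L * Q) = 1\<^sub>m n"
    using sym_pos_def_inv[OF Q] fac L Qc by (simp add: assoc_mult_mat[of _ n n _ n _ n])
  then have "(L * Q) * transpose_mat L = 1\<^sub>m n"
    by (rule mat_mult_left_right_inverse[rotated 2]) (use L Qc in auto)
  then have LP: "L * (Q * transpose_mat L) = 1\<^sub>m n"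
    using L Qc by (simp add: assoc_mult_mat[of _ n n _ n _ n])
  have Pc: "Q * transpose_mat L \<in> carrier_mat n n" using L Qc by auto
  show inv: "mat_inv L = Q * transpose_mat L"
    by (rule mat_inv_unique[OF L Pc LP])
  have PL: "(Q * transpose_mat L) * L = 1\<^sub>m n"
    by (rule mat_mult_left_right_inverse[OF L Pc LP])
  have "transpose_mat (Q * transpose_mat L) = L * Q"
    using L Qc Qt by (subst transpose_mult[OF Qc, of _ n]) auto
  then show "mat_inv L * transpose_mat (mat_inv L) = Q"
    using inv PL L Qc assoc_mult_mat[OF Pc L Qc] by simp
qed

section \<open>Scalar products and uniqueness of regularized least squares minimizers\<close>

lemma scalar_prod_self_nonneg: "x \<bullet> x \<ge> (0 :: real)"
  by (auto simp: scalar_prod_def intro: sum_nonneg)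

lemma scalar_prod_self_eq_0:
  fixes x :: "real vec"
  assumes "x \<in> carrier_vec n" "x \<bullet> x = 0"
  shows "x = 0\<^sub>v n"
  using assms conjugate_square_eq_0_vec[OF assms(1)] by simp

lemma euclid_norm_square: "(euclid_norm x)\<^sup>2 = x \<bullet> x"
  using scalar_prod_self_nonneg[of x] by (simp add: euclid_norm_def)

text \<open>The parallelogram law, written as a quantitative form of strict convexity of the squared
  norm.\<close>

lemma scalar_prod_midpoint:
  fixes r s :: "real vec"
  assumes "r \<in> carrier_vec n" "s \<in> carrier_vec n"
  shows "(1/2 \<cdot>\<^sub>v (r + s)) \<bullet> (1/2 \<cdot>\<^sub>v (r + s)) =
    (r \<bullet> r) / 2 + (s \<bullet> s) / 2 - ((r - s) \<bullet> (r - s)) / 4"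
proof -
  have "s \<bullet> r = r \<bullet> s" by (rule comm_scalar_prod[OF assms(2,1)])
  then show ?thesis using assms
    by (simp add: add_scalar_prod_distrib[of _ n] scalar_prod_add_distrib[of _ n]
        minus_scalar_prod_distrib[of _ n] scalar_prod_minus_distrib[of _ n] field_simps)
qed

text \<open>At the midpoint of two minimizers, \<open>F\<close> lies below the minimal value by a
  quarter of the squared residual difference plus the weighted squared distance. Minimality forces
  this gap to vanish, and injectivity of \<open>B\<close> turns equal residuals into equal
  arguments.\<close>

lemma regularized_least_squares_unique:
  fixes B :: "real mat"
  assumes B: "B \<in> carrier_mat m k" and c: "c \<in> carrier_vec m"
    and inj: "\<And>x. x \<in> carrier_vec k \<Longrightarrow> B *\<^sub>v x = 0\<^sub>v m \<Longrightarrow> x = 0\<^sub>v k"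
    and F: "\<And>x. F x = (B *\<^sub>v x - c) \<bullet> (B *\<^sub>v x - c) + lam\<^sup>2 * (x \<bullet> x)"
    and y: "y \<in> carrier_vec k" "\<And>x. x \<in> carrier_vec k \<Longrightarrow> F y \<le> F x"
    and z: "z \<in> carrier_vec k" "\<And>x. x \<in> carrier_vec k \<Longrightarrow> F z \<le> F x"
  shows "y = z"
proof -
  define s where "s = 1/2 \<cdot>\<^sub>v (y + z)"
  have s: "s \<in> carrier_vec k" using y z by (simp add: s_def)
  define r t where "r = B *\<^sub>v y - c" and "t = B *\<^sub>v z - c"
  have rt: "r \<in> carrier_vec m" "t \<in> carrier_vec m" using B c y z by (auto simp: r_def t_def)
  have By: "B *\<^sub>v y \<in> carrier_vec m" and Bz: "B *\<^sub>v z \<in> carrier_vec m" using B y z by auto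
  have "B *\<^sub>v s - c = 1/2 \<cdot>\<^sub>v (B *\<^sub>v y + B *\<^sub>v z) - c"
    using B y z by (simp add: s_def mult_mat_vec[OF B] mult_add_distrib_mat_vec[OF B])
  also have "\<dots> = 1/2 \<cdot>\<^sub>v (r + t)"
    using B By Bz c by (intro eq_vecI) (auto simp: r_def t_def field_simps)
  finally have Bs: "B *\<^sub>v s - c = 1/2 \<cdot>\<^sub>v (r + t)" .
  have "F s = F y / 2 + F z / 2 - ((r - t) \<bullet> (r - t) + lam\<^sup>2 * ((y - z) \<bullet> (y - z))) / 4"
    unfolding F Bs scalar_prod_midpoint[OF rt] r_def[symmetric] t_def[symmetric]
    unfolding s_def scalar_prod_midpoint[OF y(1) z(1)] by (simp add: field_simps)
  moreover have "F y \<le> F s" "F z \<le> F s" using y(2) z(2) s by auto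
  moreover have "lam\<^sup>2 * ((y - z) \<bullet> (y - z)) \<ge> 0" by (simp add: scalar_prod_self_nonneg)
  \<comment> \<open>Averaging the two minimality inequalities bounds the gap by zero. The
    regularization part is only estimated from below by zero, so the argument covers
    \<open>lam = 0\<close> as well.\<close>
  ultimately have "(r - t) \<bullet> (r - t) \<le> 0" by (simp add: field_simps)
  then have "(r - t) \<bullet> (r - t) = 0" using scalar_prod_self_nonneg[of "r - t"] by linarith
  then have "r - t = 0\<^sub>v m" using rt by (intro scalar_prod_self_eq_0) auto
  moreover have "B *\<^sub>v (y - z) = B *\<^sub>v y - B *\<^sub>v z"
    by (rule mult_minus_distrib_mat_vec[OF B y(1) z(1)])
  moreover have "B *\<^sub>v y - B *\<^sub>v z = r - t"
    unfolding r_def t_def by (rule eq_vecI) (use B c in auto)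
  ultimately have "B *\<^sub>v (y - z) = 0\<^sub>v m" by simp
  then have yz: "y - z = 0\<^sub>v k" using inj y(1) z(1) by simp
  show "y = z"
  proof (rule eq_vecI)
    fix i assume "i < dim_vec z"
    then have "(y - z) $ i = y $ i - z $ i" "0\<^sub>v k $ i = (0 :: real)" using z(1) by auto
    then show "y $ i = z $ i" unfolding yz by simp
  qed (use y(1) z(1) in simp)
qed

section \<open>Isometries, stacked matrices and powers acting on vectors\<close>

text \<open>Applied later with \<open>U\<close> to the residual and with \<open>W\<close> to the
  penalty term.\<close>

lemma orthonormal_columns_isometry:
  fixes W :: "real mat"
  assumes W: "W \<in> carrier_mat n k" and orth: "transpose_mat W * W = 1\<^sub>m k"
    and y: "y \<in> carrier_vec k"
  shows "(W *\<^sub>v y) \<bullet> (W *\<^sub>v y) = y \<bullet> y"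
proof -
  have "(W *\<^sub>v y) \<bullet> (W *\<^sub>v y) = (transpose_mat W *\<^sub>v (W *\<^sub>v y)) \<bullet> y"
    using W y by (simp add: transpose_vec_mult_scalar[OF W y])
  also have "transpose_mat W *\<^sub>v (W *\<^sub>v y) = y"
    using W y orth by (metis assoc_mult_mat_vec one_mult_mat_vec transpose_carrier_mat)
  finally show ?thesis .
qed

text \<open>Each column of the stacked matrix is a concatenation of two columns, so its scalar
  product with a concatenated vector splits. This evaluates the normal equations of the Tikhonov
  problem blockwise.\<close>

lemma transpose_append_rows_mult_vec:
  fixes S T :: "real mat"
  assumes S: "S \<in> carrier_mat m n" and T: "T \<in> carrier_mat l n"
    and x: "x \<in> carrier_vec m" and y: "y \<in> carrier_vec l"
  shows "transpose_mat (S @\<^sub>r T) *\<^sub>v (x @\<^sub>v y) = transpose_mat S *\<^sub>v x + transpose_mat T *\<^sub>v y"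
proof (rule eq_vecI)
  show "dim_vec (transpose_mat (S @\<^sub>r T) *\<^sub>v (x @\<^sub>v y)) =
      dim_vec (transpose_mat S *\<^sub>v x + transpose_mat T *\<^sub>v y)"
    using carrier_append_rows[OF S T] T by auto
next
  fix j assume "j < dim_vec (transpose_mat S *\<^sub>v x + transpose_mat T *\<^sub>v y)"
  then have j: "j < n" using T by simp
  have "col (S @\<^sub>r T) j = col S j @\<^sub>v col T j"
    unfolding append_rows_def using S T j by (intro col_four_block_mat) auto
  then show "(transpose_mat (S @\<^sub>r T) *\<^sub>v (x @\<^sub>v y)) $ j =
      (transpose_mat S *\<^sub>v x + transpose_mat T *\<^sub>v y) $ j"
    using carrier_matD[OF carrier_append_rows[OF S T]] S T x y j
    by (simp add: scalar_prod_append[of _ m _ l])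
qed

lemma smult_one_mult_mat_vec:
  fixes x :: "real vec"
  assumes "x \<in> carrier_vec n"
  shows "(c \<cdot>\<^sub>m 1\<^sub>m n) *\<^sub>v x = c \<cdot>\<^sub>v x"
  using assms by (intro eq_vecI) auto

text \<open>Powers are defined with the new factor on the right; the Krylov recursion needs it on
  the left.\<close>

lemma pow_mat_Suc_mult_vec:
  assumes M: "M \<in> carrier_mat n n" and g: "g \<in> carrier_vec n"
  shows "(M ^\<^sub>m Suc j) *\<^sub>v g = M *\<^sub>v ((M ^\<^sub>m j) *\<^sub>v g)"
proof -
  have "M ^\<^sub>m Suc j = M * M ^\<^sub>m j"
  proof (induction j)
    case (Suc j)
    have "M ^\<^sub>m Suc (Suc j) = (M * M ^\<^sub>m j) * M" using Suc by simp
    also have "\<dots> = M * (M ^\<^sub>m j * M)"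
      by (rule assoc_mult_mat[OF M _ M]) (use M in auto)
    finally show ?case by simp
  qed (use M in auto)
  then show ?thesis using assoc_mult_mat_vec[OF M _ g, of "M ^\<^sub>m j"] M by (simp del: pow_mat.simps)
qed

section \<open>Krylov spaces generated by a recurrence\<close>

context
  fixes n :: nat
begin

interpretation vec_space "TYPE(real)" n .

text \<open>The preimage of \<open>span Y\<close> under \<open>M\<close> is a submodule, so it
  contains \<open>span X\<close> as soon as it contains \<open>X\<close>.\<close>

lemma mult_mat_vec_span:
  assumes M: "M \<in> carrier_mat n n" and X: "X \<subseteq> carrier_vec n" and Y: "Y \<subseteq> carrier_vec n"
    and XY: "\<And>x. x \<in> X \<Longrightarrow> M *\<^sub>v x \<in> span Y" and x: "x \<in> span X"
  shows "M *\<^sub>v x \<in> span Y"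
proof -
  let ?N = "{x \<in> carrier_vec n. M *\<^sub>v x \<in> span Y}"
  have "submodule class_ring ?N V"
  proof (rule submodule.intro)
    show "module class_ring V" by unfold_locales
    show "?N \<subseteq> carrier V" by (auto simp: module_vec_simps)
    have "M *\<^sub>v 0\<^sub>v n = 0\<^sub>v n" using M by (intro eq_vecI) auto
    then show "\<zero>\<^bsub>V\<^esub> \<in> ?N" using span_zero[of Y] by (auto simp: module_vec_simps)
    show "x \<oplus>\<^bsub>V\<^esub> y \<in> ?N" if "x \<in> ?N" "y \<in> ?N" for x y
      using that span_add1[of Y] Y
      by (auto simp: module_vec_simps mult_add_distrib_mat_vec[OF M])
    show "c \<odot>\<^bsub>V\<^esub> x \<in> ?N" if "c \<in> carrier class_ring" "x \<in> ?N" for c x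
      using that smult_in_span[OF Y] by (auto simp: module_vec_simps mult_mat_vec[OF M])
  qed
  then have "span X \<subseteq> ?N" using X XY by (intro span_is_subset) auto
  then show ?thesis using x by auto
qed

text \<open>Modulo the span of \<open>q 0\<close>, ..., \<open>q i\<close>, the vector
  \<open>M *\<^sub>v q i\<close> is a nonzero multiple of \<open>q (Suc i)\<close>. Hence the power
  sequence and the sequence \<open>q\<close> gain the same direction at each stage, and their spans
  agree by induction.\<close>

lemma krylov_eq_span:
  assumes M: "M \<in> carrier_mat n n"
    and q: "\<And>i. i \<le> k \<Longrightarrow> q i \<in> carrier_vec n"
    and g: "g = c0 \<cdot>\<^sub>v q 0" "c0 \<noteq> 0"
    and rec: "\<And>i. i < k \<Longrightarrow> c i \<noteq> 0"
      "\<And>i. i < k \<Longrightarrow> M *\<^sub>v q i - c i \<cdot>\<^sub>v q (Suc i) \<in> span (q ` {..i})"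
  shows "krylov (Suc k) M g = span (q ` {..k})"
proof -
  define G where "G j = (M ^\<^sub>m j) *\<^sub>v g" for j
  have gc: "g \<in> carrier_vec n" using g q[of 0] by simp
  have G: "G j \<in> carrier_vec n" for j using M gc unfolding G_def by (intro mult_mat_vec_carrier) auto
  have GS: "M *\<^sub>v G j = G (Suc j)" for j
    unfolding G_def by (rule pow_mat_Suc_mult_vec[OF M gc, symmetric])
  have "span (G ` {..k}) = span (q ` {..k})"
    using q rec
  proof (induction k)
    case 0
    have G0: "G 0 = c0 \<cdot>\<^sub>v q 0" using M gc g by (simp add: G_def)
    have q0: "q 0 \<in> carrier_vec n" by (rule 0(1)) simp
    have "q 0 = (1 / c0) \<cdot>\<^sub>v G 0" using G0 g(2) q0 by (simp add: smult_smult_assoc)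
    then have "q 0 \<in> span {G 0}" using smult_in_span[OF _ span_self[OF G], of 0] G[of 0] by simp
    moreover have "G 0 \<in> span {q 0}"
      using smult_in_span[OF _ span_self[of "q 0"], of c0] q0 by (simp add: G0)
    ultimately show ?case using G[of 0] q0 by (intro equalityI span_subsetI) auto
  next
    case (Suc k)
    let ?X = "G ` {..k}" and ?Y = "q ` {..k}" and ?X' = "G ` {..Suc k}" and ?Y' = "q ` {..Suc k}"
    have IH: "span ?X = span ?Y" using Suc by auto
    have c: "?X \<subseteq> carrier_vec n" "?Y \<subseteq> carrier_vec n" "?X' \<subseteq> carrier_vec n" "?Y' \<subseteq> carrier_vec n"
      using G Suc.prems(1) by auto
    have X': "span ?X \<subseteq> span ?X'" and Y': "span ?Y \<subseteq> span ?Y'"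
      by (intro span_is_monotone image_mono; simp)+
    \<comment> \<open>First inclusion: \<open>M\<close> sends all old generators \<open>q i\<close>
      into the enlarged span, because the recurrence expresses the image through \<open>q 0\<close>,
      ..., \<open>q (Suc i)\<close>. By the induction hypothesis this applies to \<open>G k\<close>,
      whose image is \<open>G (Suc k)\<close>.\<close>
    have Mq: "M *\<^sub>v q i \<in> span ?Y'" if "i \<le> k" for i
    proof -
      have cq: "q i \<in> carrier_vec n" "q (Suc i) \<in> carrier_vec n" using that Suc.prems(1) by auto
      have "span (q ` {..i}) \<subseteq> span ?Y'" using that by (intro span_is_monotone) auto
      then have "M *\<^sub>v q i - c i \<cdot>\<^sub>v q (Suc i) \<in> span ?Y'" using Suc.prems(3)[of i] that by auto
      moreover have "c i \<cdot>\<^sub>v q (Suc i) \<in> span ?Y'"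
        using that by (intro smult_in_span c span_mem[OF c(4)]) auto
      ultimately have "(M *\<^sub>v q i - c i \<cdot>\<^sub>v q (Suc i)) + c i \<cdot>\<^sub>v q (Suc i) \<in> span ?Y'"
        using span_add1[of ?Y'] c by auto
      also have "(M *\<^sub>v q i - c i \<cdot>\<^sub>v q (Suc i)) + c i \<cdot>\<^sub>v q (Suc i) = M *\<^sub>v q i"
        using M cq by (intro eq_vecI) auto
      finally show ?thesis .
    qed
    have GX: "G i \<in> span ?X" if "i \<le> k" for i using that c by (intro span_mem) auto
    have qY: "q i \<in> span ?Y" if "i \<le> k" for i using that c by (intro span_mem) auto
    have "G (Suc k) \<in> span ?Y'"
      using mult_mat_vec_span[OF M c(2,4), of "G k"] Mq GX[of k] IH by (auto simp: GS)
    then have "G i \<in> span ?Y'" if "i \<le> Suc k" for i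
      using that GX[of i] IH Y' by (cases "i = Suc k") auto
    then have 1: "span ?X' \<subseteq> span ?Y'" using c by (intro span_subsetI) auto
    \<comment> \<open>Second inclusion: the recurrence is solved for \<open>q (Suc k)\<close> by
      subtracting the remainder \<open>?r\<close> and dividing by \<open>c k\<close>. The term
      \<open>M *\<^sub>v q k\<close> is available since \<open>q k\<close> lies in
      \<open>span ?X\<close> and \<open>M\<close> shifts each \<open>G j\<close> to
      \<open>G (Suc j)\<close>.\<close>
    let ?r = "M *\<^sub>v q k - c k \<cdot>\<^sub>v q (Suc k)"
    have cq: "q k \<in> carrier_vec n" "q (Suc k) \<in> carrier_vec n" using Suc.prems(1) by auto
    have "M *\<^sub>v q k \<in> span ?X'"
    proof (rule mult_mat_vec_span[OF M c(1,3)])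
      show "q k \<in> span ?X" using qY IH by auto
      show "M *\<^sub>v x \<in> span ?X'" if "x \<in> ?X" for x
        using that c by (auto simp: GS intro!: span_mem)
    qed
    moreover have "(- 1) \<cdot>\<^sub>v ?r \<in> span ?X'"
      using Suc.prems(3)[of k] IH X' c by (intro smult_in_span) auto
    ultimately have "M *\<^sub>v q k + (- 1) \<cdot>\<^sub>v ?r \<in> span ?X'" using span_add1[of ?X'] c by auto
    then have "(1 / c k) \<cdot>\<^sub>v (M *\<^sub>v q k + (- 1) \<cdot>\<^sub>v ?r) \<in> span ?X'" using c by (intro smult_in_span)
    also have "(1 / c k) \<cdot>\<^sub>v (M *\<^sub>v q k + (- 1) \<cdot>\<^sub>v ?r) = q (Suc k)"
      using M cq Suc.prems(2)[of k] by (intro eq_vecI) auto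
    finally have "q i \<in> span ?X'" if "i \<le> Suc k" for i
      using that qY[of i] IH X' by (cases "i = Suc k") auto
    then have "span ?Y' \<subseteq> span ?X'" using c by (intro span_subsetI) auto
    with 1 show ?case by auto
  qed
  moreover have "dim_vec g = n" using gc by simp
  ultimately show ?thesis by (simp add: krylov_def G_def lessThan_Suc_atMost)
qed

end

section \<open>The ordinary Golub-Kahan process and its orthonormality\<close>

text \<open>All indices are shifted down by one against the usual numbering: \<open>p 0\<close>, \<open>q 0\<close>, \<open>a 0\<close>, \<open>b 0\<close>
  stand for \<open>p\<^sub>1\<close>, \<open>q\<^sub>1\<close>, \<open>\<alpha>\<^sub>1\<close>, \<open>\<beta>\<^sub>1\<close>.\<close>

locale golub_kahan =
  fixes S :: "real mat" and m n k :: nat and a b :: "nat \<Rightarrow> real" and p q :: "nat \<Rightarrow> real vec"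
  assumes S: "S \<in> carrier_mat m n"
    and p: "\<And>i. i \<le> k \<Longrightarrow> p i \<in> carrier_vec m" and q: "\<And>i. i \<le> k \<Longrightarrow> q i \<in> carrier_vec n"
    and p_unit: "\<And>i. i \<le> k \<Longrightarrow> p i \<bullet> p i = 1" and q_unit: "\<And>i. i \<le> k \<Longrightarrow> q i \<bullet> q i = 1"
    and a_pos: "\<And>i. i \<le> k \<Longrightarrow> a i > 0" and b_pos: "\<And>i. i \<le> k \<Longrightarrow> b i > 0"
    and St_p_0: "transpose_mat S *\<^sub>v p 0 = a 0 \<cdot>\<^sub>v q 0"
    and S_q: "\<And>i. i < k \<Longrightarrow> S *\<^sub>v q i = a i \<cdot>\<^sub>v p i + b (Suc i) \<cdot>\<^sub>v p (Suc i)"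
    and St_p_Suc: "\<And>i. i < k \<Longrightarrow>
      transpose_mat S *\<^sub>v p (Suc i) = a (Suc i) \<cdot>\<^sub>v q (Suc i) + b (Suc i) \<cdot>\<^sub>v q i"
begin

lemma St: "transpose_mat S \<in> carrier_mat n m"
  using S by simp

text \<open>Both families are treated in one induction, since each new vector is tested against the
  other family through the adjoint of \<open>S\<close>. Evaluating the same scalar product by both
  recurrences isolates the new product, whose coefficient \<open>b (Suc j)\<close> or
  \<open>a (Suc j)\<close> is positive.\<close>

lemma orthogonal:
  assumes "j \<le> k" "i < j"
  shows "p j \<bullet> p i = 0 \<and> q j \<bullet> q i = 0"
  using assms
proof (induction j arbitrary: i)
  case (Suc j)
  have j: "j < k" using Suc.prems by simp
  have pp: "p j \<bullet> p i = (if i = j then 1 else 0)" if "i \<le> j" for i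
    using that Suc.IH[of i] p_unit[of j] j by auto
  have qq: "q j \<bullet> q i = (if i = j then 1 else 0)" if "i \<le> j" for i
    using that Suc.IH[of i] q_unit[of j] j by auto
  have P: "p (Suc j) \<bullet> p i = 0" if i: "i \<le> j" for i
  proof -
    have c: "p j \<in> carrier_vec m" "p (Suc j) \<in> carrier_vec m" "p i \<in> carrier_vec m"
      "q j \<in> carrier_vec n" "q i \<in> carrier_vec n"
      using p q i j by auto
    have "(S *\<^sub>v q j) \<bullet> p i = p i \<bullet> (S *\<^sub>v q j)" using S c by (intro comm_scalar_prod) auto
    also have "\<dots> = (transpose_mat S *\<^sub>v p i) \<bullet> q j"
      by (rule transpose_vec_mult_scalar[OF S, symmetric]) (use c in auto)
    also have "\<dots> = q j \<bullet> (transpose_mat S *\<^sub>v p i)" using S c by (intro comm_scalar_prod) auto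
    \<comment> \<open>\<open>transpose_mat S *\<^sub>v p i\<close> involves only \<open>q i\<close>
      and, for positive \<open>i\<close>, its predecessor. As \<open>i \<le> j\<close>, only
      \<open>q i\<close> can meet \<open>q j\<close>, and only when \<open>i = j\<close>.\<close>
    also have "\<dots> = (if i = j then a j else 0)"
    proof (cases i)
      case 0
      then show ?thesis using qq[of 0] c by (simp add: St_p_0)
    next
      case (Suc l)
      then have "q l \<in> carrier_vec n" using q i j by auto
      then show ?thesis using Suc qq[of i] qq[of l] c i j
        by (simp add: St_p_Suc scalar_prod_add_distrib[of _ n])
    qed
    finally have "a j * (p j \<bullet> p i) + b (Suc j) * (p (Suc j) \<bullet> p i) = (if i = j then a j else 0)"
      using c j by (simp add: S_q add_scalar_prod_distrib[of _ m])
    then show ?thesis using pp[OF i] b_pos[of "Suc j"] j by (auto split: if_splits)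
  qed
  \<comment> \<open>The new \<open>p (Suc j)\<close> is already known to be orthogonal to its
    predecessors, so it meets \<open>S *\<^sub>v q i\<close> only through \<open>p (Suc i)\<close>
    with \<open>i = j\<close>. That contribution \<open>b (Suc j)\<close> cancels against the
    \<open>q j\<close> term of the recurrence.\<close>
  have Q: "q (Suc j) \<bullet> q i = 0" if i: "i \<le> j" for i
  proof -
    have c: "p (Suc j) \<in> carrier_vec m" "p i \<in> carrier_vec m" "p (Suc i) \<in> carrier_vec m"
      "q j \<in> carrier_vec n" "q (Suc j) \<in> carrier_vec n" "q i \<in> carrier_vec n"
      using p q i j by auto
    have "(transpose_mat S *\<^sub>v p (Suc j)) \<bullet> q i = p (Suc j) \<bullet> (S *\<^sub>v q i)"
      by (rule transpose_vec_mult_scalar[OF S]) (use c in auto)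
    also have "\<dots> = a i * (p (Suc j) \<bullet> p i) + b (Suc i) * (p (Suc j) \<bullet> p (Suc i))"
      using c i j by (simp add: S_q scalar_prod_add_distrib[of _ m])
    also have "\<dots> = (if i = j then b (Suc j) else 0)"
      using P[of i] P[of "Suc i"] p_unit[of "Suc j"] i j by auto
    finally have "a (Suc j) * (q (Suc j) \<bullet> q i) + b (Suc j) * (q j \<bullet> q i) =
        (if i = j then b (Suc j) else 0)"
      using c j by (simp add: St_p_Suc add_scalar_prod_distrib[of _ n])
    then show ?thesis using qq[OF i] a_pos[of "Suc j"] j by (auto split: if_splits)
  qed
  from P Q Suc.prems show ?case by auto
qed simp

lemma p_orthonormal:
  assumes "i \<le> k" "j \<le> k"
  shows "p i \<bullet> p j = (if i = j then 1 else 0)"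
  using orthogonal[of i j] orthogonal[of j i] p_unit assms comm_scalar_prod[OF p p, of i j]
  by (cases i j rule: linorder_cases) auto

lemma q_orthonormal:
  assumes "i \<le> k" "j \<le> k"
  shows "q i \<bullet> q j = (if i = j then 1 else 0)"
  using orthogonal[of i j] orthogonal[of j i] q_unit assms comm_scalar_prod[OF q q, of i j]
  by (cases i j rule: linorder_cases) auto

section \<open>Matrix form of the recurrences\<close>

text \<open>\<open>U\<close> has one column more than \<open>W\<close>, because the recurrence for
  \<open>S *\<^sub>v q j\<close> reaches \<open>p (Suc j)\<close>.\<close>

definition "U = mat_of_cols m (map p [0..<Suc k])"
definition "W = mat_of_cols n (map q [0..<k])"
text \<open>This is \<open>B_mat\<close> in the shifted numbering: \<open>b (Suc j)\<close> stands
  for \<beta> with index j + 2.\<close>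

definition "B = mat (Suc k) k (\<lambda>(i, j). if i = j then a j else if i = Suc j then b (Suc j) else 0)"

lemma U: "U \<in> carrier_mat m (Suc k)" and W: "W \<in> carrier_mat n k" and B: "B \<in> carrier_mat (Suc k) k"
  using mat_of_cols_carrier(1)[of m "map p [0..<Suc k]"] mat_of_cols_carrier(1)[of n "map q [0..<k]"]
  by (simp_all add: U_def W_def B_def del: upt_Suc)

lemma col_U: "i \<le> k \<Longrightarrow> col U i = p i"
  unfolding U_def using p[of i] by (subst col_mat_of_cols) (auto simp del: upt_Suc)

lemma col_W: "i < k \<Longrightarrow> col W i = q i"
  unfolding W_def using q[of i] by (subst col_mat_of_cols) auto

lemma orthonormal_U: "transpose_mat U * U = 1\<^sub>m (Suc k)"
  using U by (intro eq_matI) (auto simp: col_U p_orthonormal)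

lemma orthonormal_W: "transpose_mat W * W = 1\<^sub>m k"
  using W by (intro eq_matI) (auto simp: col_W q_orthonormal)

lemma bidiagonalization: "S * W = U * B"
proof (rule eq_matI)
  fix i j assume "i < dim_row (U * B)" "j < dim_col (U * B)"
  then have i: "i < m" and j: "j < k" using U B by auto
  have "(S * W) $$ (i, j) = (S *\<^sub>v q j) $ i"
    using S W i j by (simp add: col_W)
  also have "\<dots> = a j * p j $ i + b (Suc j) * p (Suc j) $ i"
    using p[of j] p[of "Suc j"] i j by (simp add: S_q)
  \<comment> \<open>The two-term recurrence is padded to a full sum; both surviving indices
    \<open>j\<close> and \<open>Suc j\<close> are in range because \<open>j < k\<close>.\<close>
  also have "\<dots> = (\<Sum>l<Suc k. (if l = j then a j * p j $ i else 0) +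
      (if l = Suc j then b (Suc j) * p (Suc j) $ i else 0))"
    using j by (subst sum.distrib) simp
  also have "\<dots> = (\<Sum>l<Suc k. p l $ i * B $$ (l, j))"
    using j by (intro sum.cong) (auto simp: B_def)
  also have "\<dots> = (\<Sum>l<Suc k. U $$ (i, l) * B $$ (l, j))"
  proof (intro sum.cong refl)
    fix l assume "l \<in> {..<Suc k}"
    then have "U $$ (i, l) = p l $ i" using U i col_U[of l] by (metis carrier_matD index_col lessThan_iff less_Suc_eq_le)
    then show "p l $ i * B $$ (l, j) = U $$ (i, l) * B $$ (l, j)" by simp
  qed
  also have "\<dots> = (U * B) $$ (i, j)"
    using U B i j by (simp add: scalar_prod_def atLeast0LessThan)
  finally show "(S * W) $$ (i, j) = (U * B) $$ (i, j)" .
qed (use S U W B in auto)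

text \<open>Forward substitution: once the earlier entries of \<open>x\<close> vanish, row
  \<open>i\<close> reduces to \<open>a i * x $ i = 0\<close> with \<open>a i\<close> positive. Row
  \<open>k\<close> is not consulted.\<close>

lemma B_injective:
  assumes x: "x \<in> carrier_vec k" and Bx: "B *\<^sub>v x = 0\<^sub>v (Suc k)"
  shows "x = 0\<^sub>v k"
proof -
  have "x $ i = 0" if "i < k" for i
    using that
  proof (induction i rule: less_induct)
    case (less i)
    have "(\<Sum>l<k. B $$ (i, l) * x $ l) = (B *\<^sub>v x) $ i"
      using B x less.prems by (simp add: scalar_prod_def atLeast0LessThan)
    also have "(\<Sum>l<k. B $$ (i, l) * x $ l) = (\<Sum>l<k. if l = i then a i * x $ i else 0)"
      using less by (intro sum.cong) (auto simp: B_def)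
    finally have "a i * x $ i = 0" using less.prems Bx by simp
    then show ?case using a_pos[of i] less.prems by simp
  qed
  then show ?thesis using x by (intro eq_vecI) auto
qed

section \<open>The Krylov space and the residual of the Tikhonov problem\<close>

text \<open>In terms of the \<open>q i\<close>, the map \<open>M\<close> acts tridiagonally, with
  coefficient \<open>a (Suc i) * b (Suc i)\<close> on the new vector. The shift by \<open>c\<close>
  affects only the coefficient of \<open>q i\<close>, so it leaves the Krylov space
  unchanged.\<close>

lemma krylov_eq_range_W:
  assumes M: "M \<in> carrier_mat n n"
    and Mx: "\<And>x. x \<in> carrier_vec n \<Longrightarrow> M *\<^sub>v x = transpose_mat S *\<^sub>v (S *\<^sub>v x) + c \<cdot>\<^sub>v x"
    and g: "g = c0 \<cdot>\<^sub>v q 0" "c0 \<noteq> 0" and k: "k > 0"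
  shows "krylov k M g = {W *\<^sub>v y |y. y \<in> carrier_vec k}"
proof -
  interpret vec_space "TYPE(real)" n .
  have colsW: "set (cols W) = q ` {..<k}"
    unfolding W_def using q by (subst cols_mat_of_cols) auto
  \<comment> \<open>The \<open>k\<close> generators carry indices \<open>0\<close> to
    \<open>k'\<close>, exactly the columns of \<open>W\<close>.\<close>
  obtain k' where k': "k = Suc k'" using k by (cases k) auto
  have "krylov (Suc k') M g = span (q ` {..k'})"
  proof (rule krylov_eq_span[where c = "\<lambda>i. a (Suc i) * b (Suc i)"])
    show "M \<in> carrier_mat n n" "g = c0 \<cdot>\<^sub>v q 0" "c0 \<noteq> 0" by fact+
    show "q i \<in> carrier_vec n" if "i \<le> k'" for i using q that k' by simp
    show "a (Suc i) * b (Suc i) \<noteq> 0" if "i < k'" for i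
      using that k' a_pos[of "Suc i"] b_pos[of "Suc i"] by simp
    show "M *\<^sub>v q i - (a (Suc i) * b (Suc i)) \<cdot>\<^sub>v q (Suc i) \<in> span (q ` {..i})" if "i < k'" for i
    proof -
      have i: "i < k" using that k' by simp
      have c: "p i \<in> carrier_vec m" "p (Suc i) \<in> carrier_vec m"
        "q i \<in> carrier_vec n" "q (Suc i) \<in> carrier_vec n"
        using p q i by auto
      have Y: "q ` {..i} \<subseteq> carrier_vec n" using q i by auto
      have qs: "q l \<in> span (q ` {..i})" if "l \<le> i" for l using that Y by (intro span_mem) auto
      have "transpose_mat S *\<^sub>v p i \<in> span (q ` {..i})"
      proof (cases i)
        case 0
        then show ?thesis using smult_in_span[OF Y qs[of 0]] by (simp add: St_p_0)
      next
        case (Suc l)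
        then show ?thesis
          using span_add1[of "q ` {..i}"] Y smult_in_span[OF Y qs[of i]] smult_in_span[OF Y qs[of l]] i
          by (simp add: St_p_Suc)
      qed
      \<comment> \<open>The square of \<open>b (Suc i)\<close> comes from the \<open>q i\<close>
        part of \<open>transpose_mat S *\<^sub>v p (Suc i)\<close>, the summand \<open>c\<close>
        from the shift.\<close>
      then have "a i \<cdot>\<^sub>v (transpose_mat S *\<^sub>v p i) + (b (Suc i) * b (Suc i) + c) \<cdot>\<^sub>v q i \<in> span (q ` {..i})"
        using span_add1[of "q ` {..i}"] Y smult_in_span[OF Y] qs[of i] by simp
      moreover have "M *\<^sub>v q i = a i \<cdot>\<^sub>v (transpose_mat S *\<^sub>v p i) +
          b (Suc i) \<cdot>\<^sub>v (transpose_mat S *\<^sub>v p (Suc i)) + c \<cdot>\<^sub>v q i"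
        using c by (simp add: Mx S_q[OF i] mult_add_distrib_mat_vec[OF St] mult_mat_vec[OF St])
      then have "M *\<^sub>v q i - (a (Suc i) * b (Suc i)) \<cdot>\<^sub>v q (Suc i) =
          a i \<cdot>\<^sub>v (transpose_mat S *\<^sub>v p i) + (b (Suc i) * b (Suc i) + c) \<cdot>\<^sub>v q i"
        using c S unfolding St_p_Suc[OF i] by (intro eq_vecI) (auto simp: algebra_simps)
      ultimately show ?thesis by simp
    qed
  qed
  also have "q ` {..k'} = set (cols W)"
    unfolding colsW by (simp add: k' lessThan_Suc_atMost)
  also have "span (set (cols W)) = {W *\<^sub>v y |y. y \<in> carrier_vec k}"
    using col_space_eq[OF W] W by (auto simp: col_space_def)
  finally show ?thesis by (simp add: k')
qed

text \<open>Since \<open>S * W = U * B\<close> and \<open>p 0\<close> is the first column of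
  \<open>U\<close>, the upper block of the residual is \<open>U\<close> applied to the small
  residual; the lower block is \<open>lam\<close> times \<open>W *\<^sub>v y\<close>. Both
  isometries preserve the norms.\<close>

lemma tikhonov_residual:
  assumes y: "y \<in> carrier_vec k"
  shows "(euclid_norm ((S @\<^sub>r (lam \<cdot>\<^sub>m 1\<^sub>m n)) *\<^sub>v (W *\<^sub>v y) - ((b0 \<cdot>\<^sub>v p 0) @\<^sub>v 0\<^sub>v n)))\<^sup>2 =
    (B *\<^sub>v y - b0 \<cdot>\<^sub>v unit_vec (Suc k) 0) \<bullet> (B *\<^sub>v y - b0 \<cdot>\<^sub>v unit_vec (Suc k) 0)
      + lam\<^sup>2 * (y \<bullet> y)"
proof -
  let ?e = "unit_vec (Suc k) 0 :: real vec"
  let ?r = "B *\<^sub>v y - b0 \<cdot>\<^sub>v ?e"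
  have r: "?r \<in> carrier_vec (Suc k)" and Wy: "W *\<^sub>v y \<in> carrier_vec n" and p0: "p 0 \<in> carrier_vec m"
    using B W y p by auto
  have "S *\<^sub>v (W *\<^sub>v y) = U *\<^sub>v (B *\<^sub>v y)"
    using bidiagonalization assoc_mult_mat_vec[OF S W y] assoc_mult_mat_vec[OF U B y] by simp
  moreover have "U *\<^sub>v ?e = col U 0" using U by (intro eq_vecI) auto
  then have "U *\<^sub>v ?e = p 0" by (simp add: col_U)
  ultimately have Ur: "S *\<^sub>v (W *\<^sub>v y) - b0 \<cdot>\<^sub>v p 0 = U *\<^sub>v ?r"
    using B y by (simp add: mult_minus_distrib_mat_vec[OF U] mult_mat_vec[OF U])
  have "(S @\<^sub>r (lam \<cdot>\<^sub>m 1\<^sub>m n)) *\<^sub>v (W *\<^sub>v y) = (S *\<^sub>v (W *\<^sub>v y)) @\<^sub>v (lam \<cdot>\<^sub>v (W *\<^sub>v y))"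
    using Wy by (subst mat_mult_append[OF S, of _ n]) (auto simp: smult_one_mult_mat_vec)
  also have "\<dots> - ((b0 \<cdot>\<^sub>v p 0) @\<^sub>v 0\<^sub>v n) = (U *\<^sub>v ?r) @\<^sub>v (lam \<cdot>\<^sub>v (W *\<^sub>v y))"
    unfolding Ur[symmetric] using S W Wy p0 by (intro eq_vecI) auto
  finally have "(euclid_norm ((S @\<^sub>r (lam \<cdot>\<^sub>m 1\<^sub>m n)) *\<^sub>v (W *\<^sub>v y) - ((b0 \<cdot>\<^sub>v p 0) @\<^sub>v 0\<^sub>v n)))\<^sup>2 =
      (U *\<^sub>v ?r) \<bullet> (U *\<^sub>v ?r) + lam\<^sup>2 * ((W *\<^sub>v y) \<bullet> (W *\<^sub>v y))"
    using mult_mat_vec_carrier[OF U r] Wy unfolding euclid_norm_square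
    by (simp add: scalar_prod_append[of _ m _ n] power2_eq_square)
  then show ?thesis
    by (simp add: orthonormal_columns_isometry[OF U orthonormal_U r]
        orthonormal_columns_isometry[OF W orthonormal_W y])
qed

text \<open>The stacked normal matrix acts as \<open>transpose_mat S * S\<close> shifted by the
  square of \<open>lam\<close>, and the zero block of the right-hand side leaves
  \<open>(b0 * a 0) \<cdot>\<^sub>v q 0\<close> as starting vector.\<close>

lemma krylov_tikhonov:
  assumes "b0 \<noteq> 0" "k > 0"
  shows "krylov k (transpose_mat (S @\<^sub>r (lam \<cdot>\<^sub>m 1\<^sub>m n)) * (S @\<^sub>r (lam \<cdot>\<^sub>m 1\<^sub>m n)))
      (transpose_mat (S @\<^sub>r (lam \<cdot>\<^sub>m 1\<^sub>m n)) *\<^sub>v ((b0 \<cdot>\<^sub>v p 0) @\<^sub>v 0\<^sub>v n)) =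
    {W *\<^sub>v y |y. y \<in> carrier_vec k}"
proof (rule krylov_eq_range_W)
  let ?T = "lam \<cdot>\<^sub>m 1\<^sub>m n"
  let ?C = "S @\<^sub>r ?T"
  have T: "?T \<in> carrier_mat n n" by simp
  have "transpose_mat ?T = ?T" by (intro eq_matI) auto
  then have Tt: "transpose_mat ?T *\<^sub>v x = lam \<cdot>\<^sub>v x" "?T *\<^sub>v x = lam \<cdot>\<^sub>v x"
    if "x \<in> carrier_vec n" for x
    using smult_one_mult_mat_vec[OF that, of lam] by simp_all
  have C: "?C \<in> carrier_mat (m + n) n" using S T by (rule carrier_append_rows)
  show "transpose_mat ?C * ?C \<in> carrier_mat n n" using C by (intro mult_carrier_mat) auto
  show "(transpose_mat ?C * ?C) *\<^sub>v x = transpose_mat S *\<^sub>v (S *\<^sub>v x) + (lam * lam) \<cdot>\<^sub>v x"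
    if x: "x \<in> carrier_vec n" for x
  proof -
    have "(transpose_mat ?C * ?C) *\<^sub>v x = transpose_mat ?C *\<^sub>v (?C *\<^sub>v x)"
      using C x by (intro assoc_mult_mat_vec) auto
    also have "\<dots> = transpose_mat S *\<^sub>v (S *\<^sub>v x) + transpose_mat ?T *\<^sub>v (?T *\<^sub>v x)"
      unfolding mat_mult_append[OF S T x]
      by (rule transpose_append_rows_mult_vec[OF S T]) (use S x in \<open>auto simp: Tt\<close>)
    finally show ?thesis using x by (simp add: Tt smult_smult_assoc)
  qed
  have p0: "p 0 \<in> carrier_vec m" "q 0 \<in> carrier_vec n" using p q by auto
  have "transpose_mat ?C *\<^sub>v ((b0 \<cdot>\<^sub>v p 0) @\<^sub>v 0\<^sub>v n) =
      transpose_mat S *\<^sub>v (b0 \<cdot>\<^sub>v p 0) + transpose_mat ?T *\<^sub>v 0\<^sub>v n"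
    by (rule transpose_append_rows_mult_vec[OF S T]) (use p0 in auto)
  also have "\<dots> = (b0 * a 0) \<cdot>\<^sub>v q 0"
    using p0 by (subst Tt(1)) (auto simp: mult_mat_vec[OF St] St_p_0 smult_smult_assoc)
  finally show "transpose_mat ?C *\<^sub>v ((b0 \<cdot>\<^sub>v p 0) @\<^sub>v 0\<^sub>v n) = (b0 * a 0) \<cdot>\<^sub>v q 0" .
  show "b0 * a 0 \<noteq> 0" using assms(1) a_pos[of 0] by simp
  show "k > 0" by fact
qed

lemma lsqr_iterate_eq:
  assumes b0: "b0 \<noteq> 0" and k: "k > 0"
    and z: "is_arg_min (\<lambda>z. 1/2 * (euclid_norm (B *\<^sub>v z - b0 \<cdot>\<^sub>v unit_vec (Suc k) 0))\<^sup>2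
            + lam\<^sup>2 / 2 * (euclid_norm z)\<^sup>2) (\<lambda>z. z \<in> carrier_vec k) z"
    and w: "LSQR_iterate k (S @\<^sub>r (lam \<cdot>\<^sub>m 1\<^sub>m n)) ((b0 \<cdot>\<^sub>v p 0) @\<^sub>v 0\<^sub>v n) w"
  shows "w = W *\<^sub>v z"
proof -
  let ?c = "b0 \<cdot>\<^sub>v unit_vec (Suc k) 0"
  define F where "F x = (B *\<^sub>v x - ?c) \<bullet> (B *\<^sub>v x - ?c) + lam\<^sup>2 * (x \<bullet> x)" for x
  \<comment> \<open>The gen-LSQR objective carries a factor one half, which does not change its
    minimizers.\<close>
  have obj: "1/2 * (euclid_norm (B *\<^sub>v x - ?c))\<^sup>2 + lam\<^sup>2 / 2 * (euclid_norm x)\<^sup>2 = F x / 2" for x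
  proof -
    have "1/2 * s + lam\<^sup>2 / 2 * t = (s + lam\<^sup>2 * t) / 2" for s t :: real
      by (simp add: field_simps)
    then show ?thesis unfolding euclid_norm_square F_def .
  qed
  have zc: "z \<in> carrier_vec k" and z_min: "F z \<le> F x" if "x \<in> carrier_vec k" for x
    using z that unfolding obj is_arg_min_linorder by simp_all
  obtain y where y: "y \<in> carrier_vec k" "w = W *\<^sub>v y"
    using w by (auto simp: LSQR_iterate_def is_arg_min_linorder krylov_tikhonov[OF b0 k])
  \<comment> \<open>LSQR minimizes the norm itself; squaring preserves the comparison of nonnegative
    norms and allows \<open>tikhonov_residual\<close> to be applied.\<close>
  have y_min: "F y \<le> F x" if "x \<in> carrier_vec k" for x
  proof -
    have "euclid_norm ((S @\<^sub>r (lam \<cdot>\<^sub>m 1\<^sub>m n)) *\<^sub>v (W *\<^sub>v y) - ((b0 \<cdot>\<^sub>v p 0) @\<^sub>v 0\<^sub>v n)) \<le>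
        euclid_norm ((S @\<^sub>r (lam \<cdot>\<^sub>m 1\<^sub>m n)) *\<^sub>v (W *\<^sub>v x) - ((b0 \<cdot>\<^sub>v p 0) @\<^sub>v 0\<^sub>v n))"
      using w that y(2)
      by (auto simp: LSQR_iterate_def is_arg_min_linorder krylov_tikhonov[OF b0 k])
    then have "(euclid_norm ((S @\<^sub>r (lam \<cdot>\<^sub>m 1\<^sub>m n)) *\<^sub>v (W *\<^sub>v y) - ((b0 \<cdot>\<^sub>v p 0) @\<^sub>v 0\<^sub>v n)))\<^sup>2 \<le>
        (euclid_norm ((S @\<^sub>r (lam \<cdot>\<^sub>m 1\<^sub>m n)) *\<^sub>v (W *\<^sub>v x) - ((b0 \<cdot>\<^sub>v p 0) @\<^sub>v 0\<^sub>v n)))\<^sup>2"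
      by (intro power_mono) (auto simp: euclid_norm_def scalar_prod_self_nonneg)
    then show ?thesis unfolding tikhonov_residual[OF y(1)] tikhonov_residual[OF that] F_def .
  qed
  have "y = z"
    by (rule regularized_least_squares_unique[OF B _ B_injective F_def y(1) y_min zc z_min])
      (use z in \<open>auto simp: is_arg_min_linorder\<close>)
  then show ?thesis using y(2) by simp
qed

end

section \<open>Transfer from the generalized process to the ordinary one\<close>

theorem theorem4p2:
  fixes A Q R L\<^sub>Q L\<^sub>R :: "real mat"
    and d b \<mu> z w :: "real vec"
    and lam :: real
    and m n k :: nat
    and \<alpha> \<beta> :: "nat \<Rightarrow> real"
    and u v :: "nat \<Rightarrow> real vec"
  assumes "m \<ge> n" and "n \<ge> 1"
    and "A \<in> carrier_mat m n"
    and "sym_pos_def n Q" and "sym_pos_def m R"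
    and "d \<in> carrier_vec m" and "\<mu> \<in> carrier_vec n"
    and "b = d - A *\<^sub>v \<mu>"
    and "L\<^sub>Q \<in> carrier_mat n n" and "L\<^sub>R \<in> carrier_mat m m"
    and "mat_inv Q = transpose_mat L\<^sub>Q * L\<^sub>Q"
    and "mat_inv R = transpose_mat L\<^sub>R * L\<^sub>R"
    and "lam \<ge> 0" and "k \<ge> 1"
    and "gen_GK A R Q b k \<alpha> \<beta> u v" and "no_breakdown k \<alpha> \<beta>"
    and "gen_LSQR_solution k lam \<alpha> \<beta> z"
    and "LSQR_iterate k
           ((L\<^sub>R * A * mat_inv L\<^sub>Q) @\<^sub>r (lam \<cdot>\<^sub>m 1\<^sub>m n))
           ((L\<^sub>R *\<^sub>v b) @\<^sub>v 0\<^sub>v n) w"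
  shows "\<mu> + (Q * V_mat n k v) *\<^sub>v z = \<mu> + mat_inv L\<^sub>Q *\<^sub>v w"
proof -
  note A = assms(3) and LQ = assms(9) and LR = assms(10) and GK = assms(15)[unfolded gen_GK_def]
  define P where "P = mat_inv L\<^sub>Q"
  define S where "S = L\<^sub>R * A * P"
  have Q: "Q \<in> carrier_mat n n" using assms(4) by (simp add: sym_pos_def_def)
  have P: "P \<in> carrier_mat n n" and PP: "P * transpose_mat P = Q"
    using mat_inv_factor[OF assms(4) LQ assms(11)] LQ Q by (auto simp: P_def)
  have Pt: "transpose_mat P \<in> carrier_mat n n" and At: "transpose_mat A \<in> carrier_mat n m"
    and LRt: "transpose_mat L\<^sub>R \<in> carrier_mat m m" using P A LR by auto
  have S: "S \<in> carrier_mat m n" using LR A P by (auto simp: S_def)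
  have St: "transpose_mat S = transpose_mat P * (transpose_mat A * transpose_mat L\<^sub>R)"
    unfolding S_def transpose_mult[OF mult_carrier_mat[OF LR A] P] transpose_mult[OF LR A] ..
  have pos: "\<alpha> i > 0" "\<beta> i > 0" if "1 \<le> i" "i \<le> k + 1" for i
    using assms(16) that by (auto simp: no_breakdown_def)
  have uv: "u i \<in> carrier_vec m" "v i \<in> carrier_vec n" if "1 \<le> i" "i \<le> k + 1" for i
    using GK A that by auto
  have Qx: "Q *\<^sub>v x = P *\<^sub>v (transpose_mat P *\<^sub>v x)" if "x \<in> carrier_vec n" for x
    using assoc_mult_mat_vec[OF P Pt that] PP by simp
  have Rx: "mat_inv R *\<^sub>v x = transpose_mat L\<^sub>R *\<^sub>v (L\<^sub>R *\<^sub>v x)" if "x \<in> carrier_vec m" for x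
    using assoc_mult_mat_vec[OF LRt LR that] assms(12) by simp
  have Rc: "mat_inv R \<in> carrier_mat m m" using LR assms(12) by auto
  \<comment> \<open>\<open>P * transpose_mat P = Q\<close> turns the preconditioned product into the
    operator \<open>A * Q\<close> of the generalized recurrence.\<close>
  have S_apply: "S *\<^sub>v (transpose_mat P *\<^sub>v x) = L\<^sub>R *\<^sub>v ((A * Q) *\<^sub>v x)" if x: "x \<in> carrier_vec n" for x
    using x LR A P Pt Q unfolding S_def
    by (simp add: Qx assoc_mult_mat_vec[of _ m n _ n] assoc_mult_mat_vec[of _ m m _ n])
  \<comment> \<open>Here \<open>transpose_mat L\<^sub>R * L\<^sub>R\<close> recombines to
    \<open>mat_inv R\<close>.\<close>
  have St_apply: "transpose_mat S *\<^sub>v (L\<^sub>R *\<^sub>v x) = transpose_mat P *\<^sub>v ((transpose_mat A * mat_inv R) *\<^sub>v x)"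
    if x: "x \<in> carrier_vec m" for x
    using x LR LRt At Pt Rc unfolding St
    by (simp add: Rx assoc_mult_mat_vec[of _ n n _ m] assoc_mult_mat_vec[of _ n m _ m])
  interpret golub_kahan S m n k "\<lambda>i. \<alpha> (Suc i)" "\<lambda>i. \<beta> (Suc i)"
    "\<lambda>i. L\<^sub>R *\<^sub>v u (Suc i)" "\<lambda>i. transpose_mat P *\<^sub>v v (Suc i)"
  proof
    fix i assume i: "i \<le> k"
    note c = uv[of "Suc i"]
    show "(L\<^sub>R *\<^sub>v u (Suc i)) \<in> carrier_vec m" "transpose_mat P *\<^sub>v v (Suc i) \<in> carrier_vec n"
      using LR Pt c i by auto
    show "\<alpha> (Suc i) > 0" "\<beta> (Suc i) > 0" using pos i by auto
    have n1: "weighted_norm (mat_inv R) (u (Suc i)) = 1" "weighted_norm Q (v (Suc i)) = 1"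
      using GK i by auto
    \<comment> \<open>Moving \<open>L\<^sub>R\<close> across the scalar product identifies the
      weighted normalization of \<open>u\<close> with the Euclidean one; \<open>P\<close> does the
      same for \<open>v\<close> below.\<close>
    have "(L\<^sub>R *\<^sub>v u (Suc i)) \<bullet> (L\<^sub>R *\<^sub>v u (Suc i)) = u (Suc i) \<bullet> (mat_inv R *\<^sub>v u (Suc i))"
      using transpose_vec_mult_scalar[OF LRt, of "L\<^sub>R *\<^sub>v u (Suc i)" "u (Suc i)"] LR c i by (simp add: Rx)
    then show "(L\<^sub>R *\<^sub>v u (Suc i)) \<bullet> (L\<^sub>R *\<^sub>v u (Suc i)) = 1"
      using n1 by (simp add: weighted_norm_def)
    have "(transpose_mat P *\<^sub>v v (Suc i)) \<bullet> (transpose_mat P *\<^sub>v v (Suc i)) = v (Suc i) \<bullet> (Q *\<^sub>v v (Suc i))"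
      using transpose_vec_mult_scalar[OF P, of "transpose_mat P *\<^sub>v v (Suc i)" "v (Suc i)"] Pt c i
      by (simp add: Qx)
    then show "(transpose_mat P *\<^sub>v v (Suc i)) \<bullet> (transpose_mat P *\<^sub>v v (Suc i)) = 1"
      using n1 by (simp add: weighted_norm_def)
  next
    fix i assume i: "i < k"
    note c = uv[of "Suc i"] uv[of "Suc (Suc i)"]
    have "\<beta> (Suc (Suc i)) \<cdot>\<^sub>v u (Suc (Suc i)) = (A * Q) *\<^sub>v v (Suc i) - \<alpha> (Suc i) \<cdot>\<^sub>v u (Suc i)"
      using GK i by auto
    moreover have "(A * Q) *\<^sub>v v (Suc i) = \<alpha> (Suc i) \<cdot>\<^sub>v u (Suc i) +
        ((A * Q) *\<^sub>v v (Suc i) - \<alpha> (Suc i) \<cdot>\<^sub>v u (Suc i))"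
      using A c i by (intro eq_vecI) auto
    ultimately have "(A * Q) *\<^sub>v v (Suc i) =
        \<alpha> (Suc i) \<cdot>\<^sub>v u (Suc i) + \<beta> (Suc (Suc i)) \<cdot>\<^sub>v u (Suc (Suc i))" by simp
    then show "S *\<^sub>v (transpose_mat P *\<^sub>v v (Suc i)) = \<alpha> (Suc i) \<cdot>\<^sub>v (L\<^sub>R *\<^sub>v u (Suc i)) +
        \<beta> (Suc (Suc i)) \<cdot>\<^sub>v (L\<^sub>R *\<^sub>v u (Suc (Suc i)))"
      using c i by (simp add: S_apply mult_add_distrib_mat_vec[OF LR] mult_mat_vec[OF LR])
    have "\<alpha> (Suc (Suc i)) \<cdot>\<^sub>v v (Suc (Suc i)) =
        (transpose_mat A * mat_inv R) *\<^sub>v u (Suc (Suc i)) - \<beta> (Suc (Suc i)) \<cdot>\<^sub>v v (Suc i)"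
      using GK i by auto
    moreover have "(transpose_mat A * mat_inv R) *\<^sub>v u (Suc (Suc i)) =
        ((transpose_mat A * mat_inv R) *\<^sub>v u (Suc (Suc i)) - \<beta> (Suc (Suc i)) \<cdot>\<^sub>v v (Suc i)) +
        \<beta> (Suc (Suc i)) \<cdot>\<^sub>v v (Suc i)"
      using A c i by (intro eq_vecI) auto
    ultimately have "(transpose_mat A * mat_inv R) *\<^sub>v u (Suc (Suc i)) =
        \<alpha> (Suc (Suc i)) \<cdot>\<^sub>v v (Suc (Suc i)) + \<beta> (Suc (Suc i)) \<cdot>\<^sub>v v (Suc i)" by simp
    then show "transpose_mat S *\<^sub>v (L\<^sub>R *\<^sub>v u (Suc (Suc i))) =
        \<alpha> (Suc (Suc i)) \<cdot>\<^sub>v (transpose_mat P *\<^sub>v v (Suc (Suc i))) +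
        \<beta> (Suc (Suc i)) \<cdot>\<^sub>v (transpose_mat P *\<^sub>v v (Suc i))"
      using c i by (simp add: St_apply mult_add_distrib_mat_vec[OF Pt] mult_mat_vec[OF Pt])
  next
    have "\<alpha> 1 \<cdot>\<^sub>v v 1 = (transpose_mat A * mat_inv R) *\<^sub>v u 1" using GK by auto
    then show "transpose_mat S *\<^sub>v (L\<^sub>R *\<^sub>v u (Suc 0)) = \<alpha> (Suc 0) \<cdot>\<^sub>v (transpose_mat P *\<^sub>v v (Suc 0))"
      using uv[of 1] by (simp add: St_apply mult_mat_vec[OF Pt, symmetric])
  qed (rule S)
  have bc: "b \<in> carrier_vec m" unfolding assms(8) using assms(6,7) A by (intro minus_carrier_vec) auto
  have "u 1 = (1 / \<beta> 1) \<cdot>\<^sub>v b" using GK by auto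
  \<comment> \<open>Positivity of \<open>\<beta> 1\<close> undoes the normalization, giving the
    right-hand side the form \<open>b0 \<cdot>\<^sub>v p 0\<close> expected by
    \<open>lsqr_iterate_eq\<close>.\<close>
  then have "b = \<beta> 1 \<cdot>\<^sub>v u 1" using bc pos[of 1] by (simp add: smult_smult_assoc)
  then have Lb: "L\<^sub>R *\<^sub>v b = \<beta> 1 \<cdot>\<^sub>v (L\<^sub>R *\<^sub>v u (Suc 0))"
    using uv[of 1] by (simp add: mult_mat_vec[OF LR])
  have B_eq: "B_mat k \<alpha> \<beta> = B"
    unfolding B_mat_def B_def by (intro eq_matI) auto
  have zc: "z \<in> carrier_vec k"
    using assms(17) by (simp add: gen_LSQR_solution_def is_arg_min_linorder)
  have wz: "w = W *\<^sub>v z"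
  proof (rule lsqr_iterate_eq)
    show "\<beta> 1 \<noteq> 0" using pos[of 1] by simp
    show "k > 0" using assms(14) by simp
    show "LSQR_iterate k (S @\<^sub>r (lam \<cdot>\<^sub>m 1\<^sub>m n)) ((\<beta> 1 \<cdot>\<^sub>v (L\<^sub>R *\<^sub>v u (Suc 0))) @\<^sub>v 0\<^sub>v n) w"
      using assms(18) by (simp add: Lb S_def P_def)
    show "is_arg_min (\<lambda>z. 1/2 * (euclid_norm (B *\<^sub>v z - \<beta> 1 \<cdot>\<^sub>v unit_vec (Suc k) 0))\<^sup>2
            + lam\<^sup>2 / 2 * (euclid_norm z)\<^sup>2) (\<lambda>z. z \<in> carrier_vec k) z"
      using assms(17) by (simp add: gen_LSQR_solution_def B_eq)
  qed
  have V: "V_mat n k v \<in> carrier_mat n k"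
    using mat_of_cols_carrier(1)[of n "map v [1..<k+1]"] by (simp add: V_mat_def del: upt_Suc)
  have "W = transpose_mat P * V_mat n k v"
  proof (rule mat_col_eqI)
    fix i assume "i < dim_col (transpose_mat P * V_mat n k v)"
    then have i: "i < k" using V by simp
    have "col (V_mat n k v) i = v (Suc i)"
      unfolding V_mat_def using i uv[of "Suc i"] by (subst col_mat_of_cols) (auto simp del: upt_Suc)
    then show "col W i = col (transpose_mat P * V_mat n k v) i"
      using i by (simp add: col_W col_mult2[OF Pt V])
  qed (use W V P in auto)
  \<comment> \<open>The remaining factor \<open>transpose_mat P\<close> in \<open>W\<close> supplies
    the second half of \<open>Q\<close>.\<close>
  then have "P *\<^sub>v w = P *\<^sub>v (transpose_mat P *\<^sub>v (V_mat n k v *\<^sub>v z))"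
    using wz assoc_mult_mat_vec[OF Pt V zc] by simp
  also have "\<dots> = (Q * V_mat n k v) *\<^sub>v z"
    using assoc_mult_mat_vec[OF Q V zc] V zc by (simp add: Qx)
  finally show ?thesis by (simp add: P_def)
qed

end
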